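(* Let $Y$ be an arbitrary real random variable and $T$ a Bernoulli distributed random variable with parameter $p$, defined on the same probability space. Then $\limsup_{\|\mathbf{t}\| \to \infty} |\psi_{(YT,T)}(\mathbf{t})| = 1$, where $\psi_{(YT,T)}(\mathbf{t}) = \mathbb{E}[\exp(i\,\mathbf{t}\cdot(YT,T))]$, $\mathbf{t}\in\mathbb{R}^2$, is the characteristic function of the random vector $(YT, T)$. *)

theory Defs
  imports "HOL-Probability.Probability"
begin

(* The library's char is the characteristic function of a measure on the real line;
   this is its analogue for a random vector X on M. *)
definition char_fun :: "'a measure \<Rightarrow> ('a \<Rightarrow> 'b::euclidean_space) \<Rightarrow> 'b \<Rightarrow> complex" where
  "char_fun M X t = (CLINT \<omega>|M. exp (\<i> * complex_of_real (t \<bullet> X \<omega>)))"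

(* bernoulli_pmf lives on bool; of_bool transports it to the values 0 and 1.
   bernoulli_pmf clamps its parameter to [0,1], hence the explicit range of p. *)
definition bernoulli_distributed :: "'a measure \<Rightarrow> real \<Rightarrow> ('a \<Rightarrow> real) \<Rightarrow> bool" where
  "bernoulli_distributed M p T \<longleftrightarrow>
     0 \<le> p \<and> p \<le> 1 \<and> T \<in> borel_measurable M \<and>
     distr M borel T = distr (measure_pmf (bernoulli_pmf p)) borel of_bool"

end

theory Submission
  imports Defs
begin

text \<open>A characteristic function has modulus at most \<open>1\<close>. Along the points \<open>(0, 2\<pi>n)\<close> the
  exponent is \<open>2\<pi>nT\<close>, a multiple of \<open>2\<pi>\<close> because \<open>T\<close> only takes the values \<open>0\<close> and \<open>1\<close>, so the
  characteristic function of \<open>(YT, T)\<close> equals \<open>1\<close> there.\<close>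

lemma (in prob_space) norm_char_fun_le_1: "cmod (char_fun M X t) \<le> 1"
proof -
  have "cmod (char_fun M X t) \<le> (\<integral>\<omega>. cmod (exp (\<i> * complex_of_real (t \<bullet> X \<omega>))) \<partial>M)"
    unfolding char_fun_def by (rule integral_norm_bound)
  also have "\<dots> = 1"
    by (simp add: prob_space)
  finally show ?thesis .
qed

text \<open>The integrand is almost everywhere the exponential of an integer multiple of
  \<open>2 * pi * \<i>\<close>, hence 1, and \<open>M\<close> has total mass 1. The integer may vary
  with \<omega>.\<close>

lemma (in prob_space) char_fun_eq_1:
  assumes [measurable]: "X \<in> borel_measurable M"
    and "AE \<omega> in M. \<exists>k::int. t \<bullet> X \<omega> = 2 * pi * k"
  shows "char_fun M X t = 1"
proof -
  have "char_fun M X t = (CLINT \<omega>|M. 1)"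
    unfolding char_fun_def
  proof (rule integral_cong_AE)
    show "AE \<omega> in M. exp (\<i> * complex_of_real (t \<bullet> X \<omega>)) = 1"
      using assms(2) by eventually_elim (auto simp: exp_eq_1)
  qed measurable
  then show ?thesis
    by (simp add: prob_space)
qed

text \<open>An almost sure statement about the value of \<open>T\<close> depends only on its law, so
  it can be checked on the image of \<open>of_bool\<close>.\<close>

lemma bernoulli_distributed_AE:
  assumes "bernoulli_distributed M p T"
  shows "AE \<omega> in M. T \<omega> = 0 \<or> T \<omega> = 1"
proof -
  have [measurable]: "T \<in> borel_measurable M"
    and eq: "distr M borel T = distr (measure_pmf (bernoulli_pmf p)) borel of_bool"
    using assms by (auto simp: bernoulli_distributed_def)
  have "AE x in distr (measure_pmf (bernoulli_pmf p)) borel of_bool. x = (0::real) \<or> x = 1"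
    by (subst AE_distr_iff) (auto simp: of_bool_def)
  then have "AE x in distr M borel T. x = 0 \<or> x = 1"
    by (simp only: eq)
  then show ?thesis
    by (subst (asm) AE_distr_iff) auto
qed

theorem lemma2p10:
  fixes M :: "'a measure" and Y T :: "'a \<Rightarrow> real" and p :: real
  assumes "prob_space M"
    and "Y \<in> borel_measurable M"
    and "bernoulli_distributed M p T"
  shows "Limsup at_infinity
           (\<lambda>t :: real^2. ereal (cmod (char_fun M (\<lambda>\<omega>. vector [Y \<omega> * T \<omega>, T \<omega>]) t))) = 1"
    (is "Limsup _ ?f = 1")
proof (rule antisym)
  interpret prob_space M by fact
  show "Limsup at_infinity ?f \<le> 1"
    by (intro Limsup_bounded always_eventually allI) (simp add: norm_char_fun_le_1)
  have period: "?f (vector [0, 2 * pi * real n]) = 1" for n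
  proof -
    have [measurable]: "Y \<in> borel_measurable M" "T \<in> borel_measurable M"
      using assms by (auto simp: bernoulli_distributed_def)
    have "char_fun M (\<lambda>\<omega>. vector [Y \<omega> * T \<omega>, T \<omega>]) (vector [0, 2 * pi * real n] :: real^2) = 1"
    proof (rule char_fun_eq_1)
      show "(\<lambda>\<omega>. vector [Y \<omega> * T \<omega>, T \<omega>] :: real^2) \<in> borel_measurable M"
        \<comment> \<open>Measurability is reduced to the two coordinates, obtained as inner
          products with the axis vectors.\<close>
        by (subst borel_measurable_euclidean_space)
          (auto simp: Basis_vec_def inner_axis forall_2)
      show "AE \<omega> in M. \<exists>k::int. (vector [0, 2 * pi * real n] :: real^2) \<bullet>
          vector [Y \<omega> * T \<omega>, T \<omega>] = 2 * pi * k"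
        using bernoulli_distributed_AE[OF assms(3)]
      proof eventually_elim
        case (elim \<omega>)
        then show ?case
          \<comment> \<open>The zero first coordinate removes \<open>Y\<close>, leaving
            \<open>2 * pi * n * T \<omega>\<close>; the witness is \<open>n * T \<omega>\<close> as
            an integer.\<close>
          by (intro exI[of _ "if T \<omega> = 0 then 0 else int n"]) (auto simp: inner_vec_def sum_2)
      qed
    qed
    then show ?thesis by simp
  qed
  show "1 \<le> Limsup at_infinity ?f"
  proof (rule ccontr)
    assume "\<not> 1 \<le> Limsup at_infinity ?f"
    \<comment> \<open>A limsup below 1 would keep \<open>?f\<close> strictly below 1 outside some
      ball, so one point of \<open>period\<close> with large norm refutes it.\<close>
    then have "eventually (\<lambda>t. ?f t < 1) at_infinity"
      by (intro Limsup_lessD) auto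
    then obtain b where b: "\<And>t. norm t \<ge> b \<Longrightarrow> ?f t < 1"
      unfolding eventually_at_infinity by blast
    \<comment> \<open>This makes the second coordinate \<open>2 * pi * n\<close> at least
      \<open>b\<close>, which already bounds the norm from below.\<close>
    obtain n :: nat where n: "b / (2 * pi) \<le> real n"
      using real_arch_simple by blast
    have "b \<le> \<bar>vector [0, 2 * pi * real n] $ (2::2)\<bar>"
      using n by (simp add: field_simps)
    also have "\<dots> \<le> norm (vector [0, 2 * pi * real n] :: real^2)"
      by (rule component_le_norm_cart)
    finally show False
      using b period by fastforce
  qed
qed

end
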